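(* Let $(\mathbf a,\mathbf b,\mathbf c)$ be the maximal forward solution, on $[0,T^* )$, of $$\dot{\mathbf a}=\mathbf b\mathbf c,\qquad \dot{\mathbf b}=\mathbf a\mathbf c^{\top},\qquad \dot{\mathbf c}=\mathbf b^{\top}\mathbf a ,$$ with $\mathbf a(t),\mathbf c(t)\in\mathbb R^m$, $\mathbf b(t)\in\mathbb R^{m\times m}$. Suppose that the final stage condition holds at some time $t_0\in[0,T^* )$. Then the solution is a condensed solution, i.e. for every index $i\in\{1,\dots,m\}$, either $\lim_{t\to T^*}c_i(t)=+\infty$ or $\lim_{t\to T^*}c_i(t)=-\infty$.
   Context: $m\ge1$ is an integer; $T^*$ is the right endpoint of the maximal interval of existence. $\mathbf b_i$ denotes the $i$-th row of $\mathbf b$ (a row vector), $\mathbf b^i$ its $i$-th column, $a_i,c_i$ the entries of $\mathbf a,\mathbf c$, and $\langle\cdot,\cdot\rangle$ the standard inner product. Final stage condition at time $t$: (1) for every $i\in\{1,\dots,m\}$, $c_i\,\mathbf a^{\top}\mathbf b^i>0$ and $a_i\,\mathbf b_i\mathbf c>0$ at time $t$; (2) for every $i,j\in\{1,\dots,m\}$, $\langle c_i\mathbf b^i,c_j\mathbf b^j\rangle>0$ and $\langle a_i\mathbf b_i,a_j\mathbf b_j\rangle>0$ at time $t$. *)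

theory Defs
  imports "HOL-Analysis.Analysis"
begin

text \<open>The half-open interval from 0 to \<open>T\<close> as a set of reals, where \<open>T\<close> may be \<open>\<infinity>\<close>.\<close>

definition forward_interval :: "ereal \<Rightarrow> real set" where
  "forward_interval T = {t. 0 \<le> t \<and> ereal t < T}"

text \<open>Matrices are indexed by row, then column. The derivative at the endpoint 0 is one-sided.\<close>

definition solves_on ::
  "ereal \<Rightarrow> (real \<Rightarrow> real^'m) \<Rightarrow> (real \<Rightarrow> real^'m^'m) \<Rightarrow> (real \<Rightarrow> real^'m) \<Rightarrow> bool" where
  "solves_on T a b c \<longleftrightarrow>
     (\<forall>t\<in>forward_interval T.
        (a has_vector_derivative b t *v c t) (at t within forward_interval T) \<and>
        (b has_vector_derivative (\<chi> i j. a t $ i * c t $ j)) (at t within forward_interval T) \<and>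
        (c has_vector_derivative transpose (b t) *v a t) (at t within forward_interval T))"

text \<open>The values of \<open>a\<close>, \<open>b\<close>, \<open>c\<close> outside the interval are irrelevant, so an extension is
  only required to agree with them on the interval.\<close>

definition maximal_forward_solution ::
  "ereal \<Rightarrow> (real \<Rightarrow> real^'m) \<Rightarrow> (real \<Rightarrow> real^'m^'m) \<Rightarrow> (real \<Rightarrow> real^'m) \<Rightarrow> bool" where
  "maximal_forward_solution T a b c \<longleftrightarrow>
     0 < T \<and> solves_on T a b c \<and>
     \<not> (\<exists>T' a' b' c'. T < T' \<and> solves_on T' a' b' c' \<and>
          (\<forall>t\<in>forward_interval T. a' t = a t \<and> b' t = b t \<and> c' t = c t))"

definition final_stage :: "real^'m \<Rightarrow> real^'m^'m \<Rightarrow> real^'m \<Rightarrow> bool" where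
  "final_stage a b c \<longleftrightarrow>
     (\<forall>i. c $ i * (a \<bullet> column i b) > 0 \<and> a $ i * (row i b \<bullet> c) > 0) \<and>
     (\<forall>i j. (c $ i *\<^sub>R column i b) \<bullet> (c $ j *\<^sub>R column j b) > 0 \<and>
            (a $ i *\<^sub>R row i b) \<bullet> (a $ j *\<^sub>R row j b) > 0)"

text \<open>Precomposing with \<^const>\<open>real_of_ereal\<close> and using the left filter at \<open>T\<close> in
  \<^typ>\<open>ereal\<close> covers both a finite \<open>T\<close> (left limit) and \<open>T = \<infinity>\<close> (limit at infinity).\<close>

definition condensed :: "ereal \<Rightarrow> (real \<Rightarrow> real^'m) \<Rightarrow> bool" where
  "condensed T c \<longleftrightarrow>
     (\<forall>i. filterlim (\<lambda>t. c (real_of_ereal t) $ i) at_top (at_left T) \<or>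
          filterlim (\<lambda>t. c (real_of_ereal t) $ i) at_bot (at_left T))"

end

theory Submission
  imports Defs
begin

text \<open>Half of the final stage condition already propagates: with \<open>p\<^sub>i = c\<^sub>i (a \<bullet> b\<^sup>i)\<close> and
  \<open>q\<^sub>i\<^sub>j = (c\<^sub>i b\<^sup>i) \<bullet> (c\<^sub>j b\<^sup>j)\<close>, positivity of all these quantities makes their derivatives
  nonnegative, and \<open>p\<^sub>i' \<ge> c\<^sub>i\<^sup>2 |a|\<^sup>2\<close>. Hence \<open>c\<^sub>i\<^sup>2\<close>, whose derivative is \<open>2 p\<^sub>i\<close>, increases, and
  for \<open>T = \<infinity>\<close> it tends to infinity at least linearly.

  Let \<open>T\<close> be finite and \<open>h\<close> the norm of \<open>(a, b, c)\<close>. The system is quadratic, so \<open>h' \<le> K h\<^sup>2\<close>, and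
  \<open>h\<^sup>2 - 3 |a|\<^sup>2\<close> is conserved, so \<open>|a|\<^sup>2 \<ge> \<kappa> h\<^sup>2\<close>. Integrating \<open>p\<^sub>i' \<ge> \<delta> h\<^sup>2\<close> twice bounds \<open>c\<^sub>i\<^sup>2\<close> from
  below by a multiple of \<open>ln h\<close> minus a constant. If \<open>c\<^sub>i\<close> were bounded, so would be \<open>h\<close>, and the
  solution could be continued beyond \<open>T\<close>. Local existence for the quadratic system is obtained from
  its power series, and continuing from the limit at \<open>T\<close> makes a uniqueness theorem unnecessary.\<close>

subsection \<open>Quadratic differential equations\<close>

text \<open>Taylor coefficients of the formal solution of x' = Q x x with value \<open>x0\<close> at
  0: the recursion compares coefficients of t^n, with the Cauchy product on the right.\<close>

fun ode_coeff :: "('a \<Rightarrow> 'a \<Rightarrow> 'a) \<Rightarrow> 'a \<Rightarrow> nat \<Rightarrow> 'a::real_normed_vector" where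
  "ode_coeff Q x0 0 = x0"
| "ode_coeff Q x0 (Suc n) =
     (1 / real (Suc n)) *\<^sub>R (\<Sum>k\<le>n. Q (ode_coeff Q x0 k) (ode_coeff Q x0 (n - k)))"

text \<open>The majorant is the scalar equation y' = K y^2 with y(0) = r, whose solution r / (1 - K
  r t) has the coefficients r (K r)^n.\<close>

lemma norm_ode_coeff_le:
  assumes Q: "\<And>x y. norm (Q x y) \<le> norm x * norm y * K"
    and "norm x0 \<le> r" "0 \<le> K"
  shows "norm (ode_coeff Q x0 n) \<le> r * (K * r) ^ n"
proof (induction n rule: less_induct)
  case (less n)
  have r: "0 \<le> r" using assms(2) norm_ge_zero order_trans by blast
  show ?case
  proof (cases n)
    case 0
    then show ?thesis using assms by simp
  next
    case (Suc m)
    have *: "norm (Q (ode_coeff Q x0 k) (ode_coeff Q x0 (m - k))) \<le> r * (K * r) ^ n" if "k \<le> m" for k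
    proof -
      have "norm (Q (ode_coeff Q x0 k) (ode_coeff Q x0 (m - k)))
          \<le> norm (ode_coeff Q x0 k) * norm (ode_coeff Q x0 (m - k)) * K"
        by (rule Q)
      also have "\<dots> \<le> (r * (K * r) ^ k) * (r * (K * r) ^ (m - k)) * K"
        using that Suc \<open>0 \<le> K\<close> r
        by (intro mult_right_mono mult_mono less.IH) auto
      also have "\<dots> = r * (K * r) ^ n"
        using that Suc by (simp add: power_add[symmetric] algebra_simps)
      finally show ?thesis .
    qed
    have "norm (\<Sum>k\<le>m. Q (ode_coeff Q x0 k) (ode_coeff Q x0 (m - k)))
        \<le> (\<Sum>k\<le>m. r * (K * r) ^ n)"
      by (rule order_trans[OF norm_sum]) (intro sum_mono *, simp)
    \<comment> \<open>The sum has m + 1 = n terms with the same bound, so the factor 1 / n of the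
      recursion cancels.\<close>
    also have "\<dots> = real n * (r * (K * r) ^ n)" using Suc by simp
    finally show ?thesis using Suc by (simp add: field_simps del: power_Suc)
  qed
qed

text \<open>The geometric bound makes the series converge for |t| < 1 / (K r), and the recursion
  turns its termwise derivative into a Cauchy product.\<close>

lemma quadratic_ode_local_solution:
  fixes Q :: "'a::euclidean_space \<Rightarrow> 'a \<Rightarrow> 'a"
  assumes "bounded_bilinear Q"
  obtains d X where "0 < d" "X 0 = x0"
    "\<And>t. \<bar>t\<bar> < d \<Longrightarrow> (X has_vector_derivative Q (X t) (X t)) (at t)"
proof -
  interpret Q: bounded_bilinear Q by fact
  obtain K where K: "0 < K" "\<And>x y. norm (Q x y) \<le> norm x * norm y * K"
    using Q.pos_bounded by blast
  \<comment> \<open>The summand 1 keeps \<open>r\<close> positive when \<open>x0\<close> is zero, so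
    that \<open>d\<close> below is a positive radius.\<close>
  define r where "r = norm x0 + 1"
  have r: "0 < r" "norm x0 \<le> r" by (auto simp: r_def add_nonneg_pos)
  define x where "x = ode_coeff Q x0"
  have x_le: "norm (x n) \<le> r * (K * r) ^ n" for n
    unfolding x_def using K r by (intro norm_ode_coeff_le) auto
  define d where "d = 1 / (K * r)"
  have d: "0 < d" using K r by (simp add: d_def)
  \<comment> \<open>The series is summed coordinatewise, so that termwise differentiation and Cauchy
    products of real series apply.\<close>
  define f where "f = (\<lambda>u t. \<Sum>n. (x n \<bullet> u) * t ^ n)"
  define X where "X = (\<lambda>t. \<Sum>u\<in>Basis. f u t *\<^sub>R u)"
  have sm: "summable (\<lambda>n. norm ((x n \<bullet> u) * t ^ n))" if "u \<in> Basis" "\<bar>t\<bar> < d" for u t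
  proof (rule summable_comparison_test')
    show "summable (\<lambda>n. r * (K * r * \<bar>t\<bar>) ^ n)"
      using that K r by (intro summable_mult summable_geometric) (auto simp: d_def field_simps abs_mult)
    show "norm (norm ((x n \<bullet> u) * t ^ n)) \<le> r * (K * r * \<bar>t\<bar>) ^ n" if "n \<ge> 0" for n
    proof -
      have "\<bar>x n \<bullet> u\<bar> \<le> r * (K * r) ^ n"
        using Basis_le_norm[OF \<open>u \<in> Basis\<close>] x_le order_trans by blast
      then have "\<bar>x n \<bullet> u\<bar> * \<bar>t\<bar> ^ n \<le> r * (K * r) ^ n * \<bar>t\<bar> ^ n"
        by (rule mult_right_mono) simp
      then show ?thesis by (simp add: abs_mult power_abs power_mult_distrib algebra_simps)
    qed
  qed
  have X_inner: "X t \<bullet> u = f u t" if "u \<in> Basis" for t u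
    using that by (simp add: X_def)
  have Q_inner: "Q y z \<bullet> w = (\<Sum>u\<in>Basis. \<Sum>v\<in>Basis. (y \<bullet> u) * (z \<bullet> v) * (Q u v \<bullet> w))" for y z w
  proof -
    have "Q y z = Q (\<Sum>u\<in>Basis. (y \<bullet> u) *\<^sub>R u) (\<Sum>v\<in>Basis. (z \<bullet> v) *\<^sub>R v)"
      by (simp add: euclidean_representation)
    also have "\<dots> = (\<Sum>u\<in>Basis. \<Sum>v\<in>Basis. ((y \<bullet> u) * (z \<bullet> v)) *\<^sub>R Q u v)"
      by (subst sum.swap) (simp add: Q.sum_left Q.sum_right Q.scaleR_left Q.scaleR_right scaleR_sum_right mult.commute)
    finally show ?thesis by (simp add: inner_sum_left)
  qed
  have deriv: "(f w has_real_derivative Q (X t) (X t) \<bullet> w) (at t)" if w: "w \<in> Basis" and t: "\<bar>t\<bar> < d" for w t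
  proof -
    have "((\<lambda>z. \<Sum>n. (x n \<bullet> w) * z^n) has_field_derivative (\<Sum>n. diffs (\<lambda>n. x n \<bullet> w) n * t^n)) (at t)"
      by (rule termdiffs_strong'[of d]) (use sm w t in \<open>auto intro: summable_norm_cancel\<close>)
    moreover have "(\<lambda>n. diffs (\<lambda>n. x n \<bullet> w) n * t^n) sums (Q (X t) (X t) \<bullet> w)"
    proof -
      have "(\<lambda>n. \<Sum>u\<in>Basis. \<Sum>v\<in>Basis. (\<Sum>k\<le>n. ((x k \<bullet> u) * t ^ k) * ((x (n - k) \<bullet> v) * t ^ (n - k))) * (Q u v \<bullet> w))
          sums (\<Sum>u\<in>Basis. \<Sum>v\<in>Basis. f u t * f v t * (Q u v \<bullet> w))"
        unfolding f_def
        by (intro sums_sum sums_mult2 Cauchy_product_sums sm t)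
      moreover have "(\<Sum>u\<in>Basis. \<Sum>v\<in>Basis. f u t * f v t * (Q u v \<bullet> w)) = Q (X t) (X t) \<bullet> w"
        by (simp add: Q_inner[of "X t"] X_inner)
      moreover have "(\<Sum>u\<in>Basis. \<Sum>v\<in>Basis. (\<Sum>k\<le>n. ((x k \<bullet> u) * t ^ k) * ((x (n - k) \<bullet> v) * t ^ (n - k))) * (Q u v \<bullet> w))
          = diffs (\<lambda>n. x n \<bullet> w) n * t^n" for n
      proof -
        \<comment> \<open>The factor \<open>Suc n\<close> in \<open>diffs\<close> cancels the
          denominator in \<open>ode_coeff\<close>.\<close>
        have "diffs (\<lambda>n. x n \<bullet> w) n * t^n = (\<Sum>k\<le>n. (Q (x k) (x (n - k)) \<bullet> w) * t^n)"
          by (simp add: diffs_def x_def inner_sum_left sum_distrib_right)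
        also have "\<dots> = (\<Sum>k\<le>n. \<Sum>u\<in>Basis. \<Sum>v\<in>Basis. ((x k \<bullet> u) * t ^ k) * ((x (n - k) \<bullet> v) * t ^ (n - k)) * (Q u v \<bullet> w))"
        proof (rule sum.cong[OF refl])
          fix k assume "k \<in> {..n}"
          then have "t ^ n = t ^ k * t ^ (n - k)" by (simp add: power_add[symmetric])
          then show "(Q (x k) (x (n - k)) \<bullet> w) * t^n = (\<Sum>u\<in>Basis. \<Sum>v\<in>Basis. ((x k \<bullet> u) * t ^ k) * ((x (n - k) \<bullet> v) * t ^ (n - k)) * (Q u v \<bullet> w))"
            by (subst Q_inner) (simp add: sum_distrib_left sum_distrib_right mult_ac)
        qed
        also have "\<dots> = (\<Sum>u\<in>Basis. \<Sum>v\<in>Basis. \<Sum>k\<le>n. ((x k \<bullet> u) * t ^ k) * ((x (n - k) \<bullet> v) * t ^ (n - k)) * (Q u v \<bullet> w))"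
          by (subst sum.swap) (rule sum.cong[OF refl], rule sum.swap)
        finally show ?thesis by (simp add: sum_distrib_right)
      qed
      ultimately show ?thesis by simp
    qed
    ultimately show ?thesis by (simp add: f_def sums_iff)
  qed
  show thesis
  proof
    show "0 < d" by fact
    have "f u 0 = x0 \<bullet> u" for u
      unfolding f_def by (subst powser_zero) (simp add: x_def)
    then show "X 0 = x0" by (simp add: X_def euclidean_representation)
    show "(X has_vector_derivative Q (X t) (X t)) (at t)" if "\<bar>t\<bar> < d" for t
      unfolding has_vector_derivative_def
      by (subst has_derivative_componentwise_within)
        (use deriv that in \<open>auto simp: X_inner has_field_derivative_def mult_commute_abs\<close>)
  qed
qed

text \<open>A bounded solution has bounded velocity, hence is Lipschitz and has a limit at
  \<open>T\<close>; a local solution started at that limit is glued on.\<close>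

lemma quadratic_ode_extension:
  fixes Q :: "'a::euclidean_space \<Rightarrow> 'a \<Rightarrow> 'a"
  assumes "bounded_bilinear Q" and "0 < T"
    and X: "\<And>t. t \<in> {0..<T} \<Longrightarrow> (X has_vector_derivative Q (X t) (X t)) (at t within {0..<T})"
    and bdd: "bounded (X ` {0..<T})"
  obtains T' Y where "T < T'"
    "\<And>t. t \<in> {0..<T'} \<Longrightarrow> (Y has_vector_derivative Q (Y t) (Y t)) (at t within {0..<T'})"
    "\<And>t. t \<in> {0..<T} \<Longrightarrow> Y t = X t"
proof -
  interpret Q: bounded_bilinear Q by fact
  obtain K where K: "0 < K" "\<And>x y. norm (Q x y) \<le> norm x * norm y * K"
    using Q.pos_bounded by blast
  obtain B where B: "0 < B" "\<And>t. t \<in> {0..<T} \<Longrightarrow> norm (X t) \<le> B"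
    using bdd by (auto simp: bounded_pos)
  have lip: "norm (X t - X s) \<le> (B * B * K) * norm (t - s)" if "s \<in> {0..<T}" "t \<in> {0..<T}" for s t
  proof (rule differentiable_bound[OF _ _ _ that(2,1)])
    show "convex {0..<T}" by simp
    fix u assume u: "u \<in> {0..<T}"
    show "(X has_derivative (\<lambda>h. h *\<^sub>R Q (X u) (X u))) (at u within {0..<T})"
      using X[OF u] by (simp add: has_vector_derivative_def)
    have "norm (Q (X u) (X u)) \<le> B * B * K"
      using K B(2)[OF u] B(1) by (intro order_trans[OF K(2)] mult_right_mono mult_mono) auto
    then show "onorm (\<lambda>h. h *\<^sub>R Q (X u) (X u)) \<le> B * B * K"
      by (intro onorm_le) (simp add: mult.commute mult_left_mono)
  qed
  have "uniformly_continuous_on {0..<T} X"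
  unfolding uniformly_continuous_on_def
  proof (intro allI impI)
    fix e :: real assume "0 < e"
    show "\<exists>d>0. \<forall>x\<in>{0..<T}. \<forall>x'\<in>{0..<T}. dist x' x < d \<longrightarrow> dist (X x') (X x) < e"
    proof (intro exI conjI ballI impI)
      show "0 < e / (B * B * K)" using \<open>0 < e\<close> B K by simp
      fix s t assume *: "s \<in> {0..<T}" "t \<in> {0..<T}" "dist t s < e / (B * B * K)"
      have "(B * B * K) * norm (t - s) < e"
        using *(3) B K by (simp add: dist_norm field_simps)
      then show "dist (X t) (X s) < e" using lip[OF *(1,2)] by (simp add: dist_norm)
    qed
  qed
  then obtain Z where "uniformly_continuous_on (closure {0..<T}) Z"
    and ZX: "\<And>t. t \<in> {0..<T} \<Longrightarrow> X t = Z t"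
    using uniformly_continuous_on_extension_on_closure by metis
  then have contZ: "continuous_on {0..T} Z"
    using \<open>0 < T\<close> by (simp add: uniformly_continuous_imp_continuous)
  have contQ: "continuous_on {0..T} (\<lambda>t. Q (Z t) (Z t))"
    by (intro Q.continuous_on contZ)
  have Z': "(Z has_vector_derivative Q (Z t) (Z t)) (at t)" if "t \<in> {0<..<T}" for t
  proof -
    have "(X has_vector_derivative Q (X t) (X t)) (at t within {0<..<T})"
      using that by (intro has_vector_derivative_within_subset[OF X]) auto
    then have "(X has_vector_derivative Q (X t) (X t)) (at t)"
      by (simp add: at_within_open[OF that])
    then show ?thesis
      using that has_vector_derivative_transform_within_open[of X _ t "{0<..<T}" Z] ZX by simp
  qed
  \<comment> \<open>Continuity and the interior derivatives give the integral equation on the closed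
    interval; differentiating it back yields the one-sided derivative at \<open>T\<close>.\<close>
  have "((\<lambda>t. Q (Z t) (Z t)) has_integral (Z t - Z 0)) {0..t}" if "t \<in> {0..T}" for t
    using that
    by (intro fundamental_theorem_of_calculus_interior Z' continuous_on_subset[OF contZ]) auto
  then have Z_int: "Z t = Z 0 + integral {0..t} (\<lambda>t. Q (Z t) (Z t))" if "t \<in> {0..T}" for t
    using that by (metis add_diff_cancel_left' diff_add_cancel add.commute integral_unique)
  have Z_deriv: "(Z has_vector_derivative Q (Z t) (Z t)) (at t within {0..T})" if "t \<in> {0..T}" for t
  proof (rule has_vector_derivative_transform[OF that])
    show "Z s = Z 0 + integral {0..s} (\<lambda>t. Q (Z t) (Z t))" if "s \<in> {0..T}" for s
      using that by (rule Z_int)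
    show "((\<lambda>s. Z 0 + integral {0..s} (\<lambda>t. Q (Z t) (Z t))) has_vector_derivative Q (Z t) (Z t))
        (at t within {0..T})"
      using has_vector_derivative_add[OF has_vector_derivative_const integral_has_vector_derivative[OF contQ that]]
      by simp
  qed
  obtain d W where d: "0 < d" and W0: "W 0 = Z T"
    and W: "\<And>t. \<bar>t\<bar> < d \<Longrightarrow> (W has_vector_derivative Q (W t) (W t)) (at t)"
    using quadratic_ode_local_solution[OF assms(1)] by metis
  have W_shift: "((\<lambda>s. W (s - T)) has_vector_derivative Q (W (t - T)) (W (t - T))) (at t within S)"
    if "t \<in> {T..<T+d}" for t S
  proof -
    have "((\<lambda>s. s - T) has_vector_derivative 1) (at t within S)"
      by (auto intro!: derivative_eq_intros)
    moreover have "(W has_vector_derivative Q (W (t - T)) (W (t - T))) (at (t - T) within (\<lambda>s. s - T) ` S)"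
      using that by (intro has_vector_derivative_at_within[OF W]) auto
    ultimately show ?thesis
      using vector_diff_chain_within[of "\<lambda>s. s - T" 1 t S W] by (simp add: o_def)
  qed
  define Y where "Y = (\<lambda>t. if t \<in> {0..T} then Z t else W (t - T))"
  show thesis
  proof
    show "T < T + d" using d by simp
    show "Y t = X t" if "t \<in> {0..<T}" for t
      using that ZX by (simp add: Y_def)
    fix t assume t: "t \<in> {0..<T + d}"
    \<comment> \<open>Both pieces contain \<open>T\<close>, the only common point of their closures;
      values and velocities agree there because \<open>W 0 = Z T\<close>.\<close>
    have un: "{0..<T+d} = {0..T} \<union> {T..<T+d}" using d \<open>0 < T\<close> by auto
    have cl: "closure {0..T} \<inter> closure {T..<T+d} = {T}"
      using d \<open>0 < T\<close> by auto
    have ins: "{0..T} \<union> {T} = {0..T}" "{T..<T+d} \<union> {T} = {T..<T+d}"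
      using d \<open>0 < T\<close> by auto
    have "((\<lambda>t. if t \<in> {0..T} then Z t else W (t - T)) has_vector_derivative
        (if t \<in> {0..T} then Q (Z t) (Z t) else Q (W (t - T)) (W (t - T)))) (at t within {0..<T+d})"
    proof (rule has_vector_derivative_If_within_closures)
      show "t \<in> {0..T} \<union> {T..<T+d}" using t un by blast
      show "{0..<T+d} = {0..T} \<union> {T..<T+d}" by fact
      show "(Z has_vector_derivative Q (Z t) (Z t)) (at t within {0..T} \<union> (closure {0..T} \<inter> closure {T..<T+d}))"
        if "t \<in> {0..T} \<union> (closure {0..T} \<inter> closure {T..<T+d})"
        using that Z_deriv unfolding cl ins by blast
      show "((\<lambda>s. W (s - T)) has_vector_derivative Q (W (t - T)) (W (t - T))) (at t within {T..<T+d} \<union> (closure {0..T} \<inter> closure {T..<T+d}))"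
        if "t \<in> {T..<T+d} \<union> (closure {0..T} \<inter> closure {T..<T+d})"
        using that W_shift unfolding cl ins by blast
      show "Z t = W (t - T)" if "t \<in> closure {0..T}" "t \<in> closure {T..<T+d}"
        using that cl W0 by (metis IntI diff_self singletonD)
      show "Q (Z t) (Z t) = Q (W (t - T)) (W (t - T))" if "t \<in> closure {0..T}" "t \<in> closure {T..<T+d}"
        using that cl W0 by (metis IntI diff_self singletonD)
    qed
    then show "(Y has_vector_derivative Q (Y t) (Y t)) (at t within {0..<T+d})"
      unfolding Y_def by (cases "t \<in> {0..T}") (simp_all only: if_True if_False simp_thms)
  qed
qed

subsection \<open>Differential inequalities\<close>

lemma has_real_derivative_inner:
  assumes "(f has_vector_derivative f') (at x within S)" "(g has_vector_derivative g') (at x within S)"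
  shows "((\<lambda>x. f x \<bullet> g x) has_real_derivative f x \<bullet> g' + f' \<bullet> g x) (at x within S)"
  using bounded_bilinear.has_vector_derivative[OF bounded_bilinear_inner assms]
  by (simp add: has_real_derivative_iff_has_vector_derivative)

text \<open>The sign is asked for only strictly between the endpoints, since a first-failure
  argument provides it only before the failure.\<close>

lemma nondecreasing_of_deriv_nonneg:
  fixes f :: "real \<Rightarrow> real"
  assumes deriv: "\<And>x. x \<in> S \<Longrightarrow> (f has_real_derivative f' x) (at x within S)"
    and nonneg: "\<And>x. s < x \<Longrightarrow> x < t \<Longrightarrow> 0 \<le> f' x"
    and "{s..t} \<subseteq> S" "s \<le> t"
  shows "f s \<le> f t"
proof (rule DERIV_nonneg_imp_increasing_open[OF \<open>s \<le> t\<close>])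
  have d: "(f has_real_derivative f' x) (at x within {s..t})" if "x \<in> {s..t}" for x
    using that assms(3) by (intro DERIV_subset[OF deriv]) auto
  then show "continuous_on {s..t} f"
    by (meson DERIV_continuous_on)
  show "\<exists>y. (f has_real_derivative y) (at x) \<and> 0 \<le> y" if "s < x" "x < t" for x
    using d[of x] nonneg that by (auto simp: at_within_Icc_at)
qed

text \<open>Before the earliest time at which some member is nonpositive, all members are positive
  and hence nondecreasing; so none can have dropped from its positive initial value.\<close>

lemma positivity_persists:
  fixes f :: "'k::finite \<Rightarrow> real \<Rightarrow> real"
  assumes deriv: "\<And>k x. x \<in> S \<Longrightarrow> (f k has_real_derivative f' k x) (at x within S)"
    and "{s..t} \<subseteq> S" "s \<le> t" and init: "\<And>k. 0 < f k s"
    and nonneg: "\<And>k x. x \<in> S \<Longrightarrow> (\<And>l. 0 < f l x) \<Longrightarrow> 0 \<le> f' k x"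
  shows "0 < f k t"
proof (rule ccontr)
  assume neg: "\<not> 0 < f k t"
  \<comment> \<open>The failure times form a finite union of closed sets, so a first one
    exists.\<close>
  define B where "B = (\<Union>k. {u \<in> {s..t}. f k u \<le> 0})"
  have "continuous_on {s..t} (f l)" for l
    by (rule continuous_on_subset[OF _ \<open>{s..t} \<subseteq> S\<close>], rule DERIV_continuous_on, rule deriv)
  then have "closed {u \<in> {s..t}. f l u \<le> 0}" for l
    by (rule continuous_on_closed_Collect_le[OF _ continuous_on_const closed_atLeastAtMost])
  then have "closed B" unfolding B_def by (intro closed_UN) auto
  moreover have "bounded B"
    by (rule bounded_subset[of "{s..t}"]) (auto simp: B_def)
  ultimately have "compact B" by (simp add: compact_eq_bounded_closed)
  moreover have "B \<noteq> {}" using neg \<open>s \<le> t\<close> by (auto simp: B_def not_less)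
  ultimately obtain u where u: "u \<in> B" and least: "\<And>v. v \<in> B \<Longrightarrow> u \<le> v"
    using compact_attains_inf by metis
  from u obtain l where l: "u \<in> {s..t}" "f l u \<le> 0" by (auto simp: B_def)
  have pos: "0 < f j v" if "s \<le> v" "v < u" for v j
  proof (rule ccontr)
    assume "\<not> 0 < f j v"
    then have "v \<in> B" using that l by (auto simp: B_def not_less)
    with least that show False by force
  qed
  have "f l s \<le> f l u"
    using l \<open>{s..t} \<subseteq> S\<close> pos
    by (intro nondecreasing_of_deriv_nonneg[OF deriv]) (auto intro!: nonneg)
  with init[of l] l show False by simp
qed

text \<open>The logarithmic lower bound on \<open>s\<close> comes from integrating \<open>p' \<ge> (\<delta> / K) h'\<close>
  and then \<open>h \<ge> (ln h)' / K\<close>.\<close>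

lemma bounded_of_log_growth:
  fixes h p s :: "real \<Rightarrow> real"
  assumes h: "\<And>x. x \<in> {t0..<T} \<Longrightarrow> (h has_real_derivative h' x) (at x within {t0..<T})"
    and p: "\<And>x. x \<in> {t0..<T} \<Longrightarrow> (p has_real_derivative p' x) (at x within {t0..<T})"
    and s: "\<And>x. x \<in> {t0..<T} \<Longrightarrow> (s has_real_derivative 2 * p x) (at x within {t0..<T})"
    and h_pos: "\<And>x. x \<in> {t0..<T} \<Longrightarrow> 0 < h x"
    and h'_le: "\<And>x. x \<in> {t0..<T} \<Longrightarrow> h' x \<le> K * (h x)\<^sup>2"
    and p'_ge: "\<And>x. x \<in> {t0..<T} \<Longrightarrow> \<delta> * (h x)\<^sup>2 \<le> p' x"
    and s_le: "\<And>x. x \<in> {t0..<T} \<Longrightarrow> s x \<le> M"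
    and "0 < K" "0 < \<delta>"
  obtains B where "\<And>x. x \<in> {t0..<T} \<Longrightarrow> h x \<le> B"
proof -
  \<comment> \<open>Chosen so that \<epsilon> K = \<delta>, which makes p - \<epsilon> h
    nondecreasing.\<close>
  define \<epsilon> where "\<epsilon> = \<delta> / K"
  have \<epsilon>: "0 < \<epsilon>" using assms by (simp add: \<epsilon>_def)
  define C where "C = \<epsilon> * h t0 - p t0"
  have p_ge: "\<epsilon> * h x - C \<le> p x" if x: "x \<in> {t0..<T}" for x
  proof -
    have "p t0 - \<epsilon> * h t0 \<le> p x - \<epsilon> * h x"
    proof (rule nondecreasing_of_deriv_nonneg[where S = "{t0..<T}" and f = "\<lambda>x. p x - \<epsilon> * h x"
          and f' = "\<lambda>x. p' x - \<epsilon> * h' x"])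
      show "((\<lambda>x. p x - \<epsilon> * h x) has_real_derivative p' y - \<epsilon> * h' y) (at y within {t0..<T})"
        if "y \<in> {t0..<T}" for y
        using that by (auto intro!: derivative_eq_intros h p)
      show "0 \<le> p' y - \<epsilon> * h' y" if "t0 < y" "y < x" for y
      proof -
        have y: "y \<in> {t0..<T}" using that x by simp
        have "\<epsilon> * h' y \<le> \<epsilon> * (K * (h y)\<^sup>2)"
          using \<epsilon> h'_le[OF y] by (intro mult_left_mono) auto
        also have "\<dots> = \<delta> * (h y)\<^sup>2" using \<open>0 < K\<close> by (simp add: \<epsilon>_def)
        finally show ?thesis using p'_ge[OF y] by simp
      qed
    qed (use x in auto)
    then show ?thesis by (simp add: C_def)
  qed
  \<comment> \<open>The term \<open>2 * C * x\<close> absorbs the constant of \<open>p_ge\<close>,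
    so that the derivative of \<open>g\<close> is at least 2 (p - \<epsilon> h + C) \<ge> 0.\<close>
  define g where "g = (\<lambda>x. s x - (2 * \<epsilon> / K) * ln (h x) + 2 * C * x)"
  have g_ge: "g t0 \<le> g x" if x: "x \<in> {t0..<T}" for x
  proof (rule nondecreasing_of_deriv_nonneg[where S = "{t0..<T}" and f = g
        and f' = "\<lambda>x. 2 * p x - (2 * \<epsilon> / K) * (h' x / h x) + 2 * C"])
    show "(g has_real_derivative 2 * p y - (2 * \<epsilon> / K) * (h' y / h y) + 2 * C) (at y within {t0..<T})"
      if "y \<in> {t0..<T}" for y
      using that h_pos[OF that] unfolding g_def
      by (auto intro!: derivative_eq_intros h s simp: divide_simps)
    show "0 \<le> 2 * p y - (2 * \<epsilon> / K) * (h' y / h y) + 2 * C" if "t0 < y" "y < x" for y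
    proof -
      have y: "y \<in> {t0..<T}" using that x by simp
      have "h' y / h y \<le> K * h y"
        using h'_le[OF y] h_pos[OF y] by (simp add: divide_simps power2_eq_square mult.assoc)
      then have "(2 * \<epsilon> / K) * (h' y / h y) \<le> (2 * \<epsilon> / K) * (K * h y)"
        using \<epsilon> \<open>0 < K\<close> by (intro mult_left_mono) auto
      also have "\<dots> = 2 * (\<epsilon> * h y)" using \<open>0 < K\<close> by simp
      finally show ?thesis using p_ge[OF y] by linarith
    qed
  qed (use x in auto)
  \<comment> \<open>Solves \<open>g t0 \<le> g x\<close> for \<open>ln (h x)\<close>, with
    \<open>s\<close> bounded by \<open>M\<close> and |x| by |t0| + |T|; finiteness of the time
    interval enters here.\<close>
  define N where "N = (M - g t0 + 2 * \<bar>C\<bar> * (\<bar>t0\<bar> + \<bar>T\<bar>)) * K / (2 * \<epsilon>)"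
  show thesis
  proof
    fix x assume x: "x \<in> {t0..<T}"
    have "C * x \<le> \<bar>C\<bar> * \<bar>x\<bar>" by (metis abs_ge_self abs_mult)
    also have "\<dots> \<le> \<bar>C\<bar> * (\<bar>t0\<bar> + \<bar>T\<bar>)" using x by (intro mult_left_mono) auto
    finally have "(2 * \<epsilon> / K) * ln (h x) \<le> M - g t0 + 2 * \<bar>C\<bar> * (\<bar>t0\<bar> + \<bar>T\<bar>)"
      using g_ge[OF x] s_le[OF x] by (simp add: g_def)
    then have "ln (h x) \<le> N"
      using \<epsilon> \<open>0 < K\<close> by (simp add: N_def field_simps)
    then show "h x \<le> exp N"
      using h_pos[OF x] by (metis exp_le_cancel_iff exp_ln)
  qed
qed

subsection \<open>The gradient system\<close>

text \<open>A non-symmetric bilinear map whose value at a repeated argument is the right-hand side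
  of the system.\<close>

definition gradient_form ::
  "(real^'m) \<times> (real^'m^'m) \<times> (real^'m) \<Rightarrow>
    (real^'m) \<times> (real^'m^'m) \<times> (real^'m) \<Rightarrow> (real^'m) \<times> (real^'m^'m) \<times> (real^'m)"
  where "gradient_form = (\<lambda>(a, b, c) (a', b', c').
    (b *v c', (\<chi> i j. a $ i * c' $ j), transpose b *v a'))"

lemma bounded_bilinear_gradient_form: "bounded_bilinear gradient_form"
proof -
  have "bilinear gradient_form"
    unfolding bilinear_def gradient_form_def
    by (auto intro!: linearI simp: vec_eq_iff matrix_vector_mult_def transpose_def
        algebra_simps sum.distrib sum_distrib_left)
  then show ?thesis by (simp add: bilinear_conv_bounded_bilinear)
qed

lemma forward_interval_ereal: "forward_interval (ereal T) = {0..<T}"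
  by (auto simp: forward_interval_def)

lemma solves_on_ereal_iff:
  "solves_on (ereal T) a b c \<longleftrightarrow>
    (\<forall>t\<in>{0..<T}. ((\<lambda>t. (a t, b t, c t)) has_vector_derivative
      gradient_form (a t, b t, c t) (a t, b t, c t)) (at t within {0..<T}))"
proof -
  have *: "((\<lambda>t. (a t, b t, c t)) has_vector_derivative (u, v, w)) (at x within S) \<longleftrightarrow>
    (a has_vector_derivative u) (at x within S) \<and> (b has_vector_derivative v) (at x within S) \<and> (c has_vector_derivative w) (at x within S)"
    (is "?l \<longleftrightarrow> ?r") for u v w x S
  proof
    assume ?l
    from has_derivative_fst[OF this[unfolded has_vector_derivative_def]]
      has_derivative_snd[OF this[unfolded has_vector_derivative_def], THEN has_derivative_fst]
      has_derivative_snd[OF this[unfolded has_vector_derivative_def], THEN has_derivative_snd]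
    show ?r by (simp add: has_vector_derivative_def)
  next
    assume ?r
    then show ?l
      by (auto simp: has_vector_derivative_def intro!: has_derivative_Pair)
  qed
  show ?thesis by (simp add: solves_on_def forward_interval_ereal gradient_form_def *)
qed

text \<open>A bounded solution could be continued by \<open>quadratic_ode_extension\<close>, against
  maximality.\<close>

lemma maximal_forward_solution_unbounded:
  assumes max: "maximal_forward_solution (ereal T) a b c"
  shows "\<not> bounded ((\<lambda>t. (a t, b t, c t)) ` {0..<T})"
proof
  assume bdd: "bounded ((\<lambda>t. (a t, b t, c t)) ` {0..<T})"
  have "0 < T" and sol: "solves_on (ereal T) a b c"
    using max by (auto simp: maximal_forward_solution_def)
  obtain T' Y where "T < T'"
    and Y: "\<And>t. t \<in> {0..<T'} \<Longrightarrow> (Y has_vector_derivative gradient_form (Y t) (Y t)) (at t within {0..<T'})"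
    and agree: "\<And>t. t \<in> {0..<T} \<Longrightarrow> Y t = (a t, b t, c t)"
    by (rule quadratic_ode_extension[OF bounded_bilinear_gradient_form \<open>0 < T\<close> _ bdd])
      (use sol in \<open>auto simp: solves_on_ereal_iff\<close>)
  have "solves_on (ereal T') (\<lambda>t. fst (Y t)) (\<lambda>t. fst (snd (Y t))) (\<lambda>t. snd (snd (Y t)))"
    using Y by (simp add: solves_on_ereal_iff)
  moreover have "\<forall>t\<in>forward_interval (ereal T).
      fst (Y t) = a t \<and> fst (snd (Y t)) = b t \<and> snd (snd (Y t)) = c t"
    using agree by (simp add: forward_interval_ereal)
  moreover have "ereal T < ereal T'" using \<open>T < T'\<close> by simp
  ultimately show False
    using max unfolding maximal_forward_solution_def by blast
qed

section \<open>Propagation of the column conditions\<close>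

locale column_final_stage =
  fixes a c :: "real \<Rightarrow> real^'m" and b :: "real \<Rightarrow> real^'m^'m" and T :: ereal and t0 :: real
  assumes sol: "solves_on T a b c"
    and t0: "t0 \<in> forward_interval T"
    and rate_init: "\<And>i. 0 < c t0 $ i * (a t0 \<bullet> column i (b t0))"
    and corr_init: "\<And>i j. 0 < (c t0 $ i *\<^sub>R column i (b t0)) \<bullet> (c t0 $ j *\<^sub>R column j (b t0))"
begin

abbreviation "F \<equiv> forward_interval T"

text \<open>Half the derivative of c_i^2; the sum over \<open>i\<close> is half the derivative of
  |a|^2.\<close>

definition "rate i t = c t $ i * (a t \<bullet> column i (b t))"

text \<open>The inner product of c_i b^i and c_j b^j with the scalars pulled out, ready for the
  product rule. Its sum over \<open>j\<close> is the inner product of c_i b^i with a'.\<close>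

definition "corr i j t = (c t $ i * c t $ j) * (column i (b t) \<bullet> column j (b t))"

lemma interval_subset: "t \<in> F \<Longrightarrow> {t0..t} \<subseteq> F"
  using t0 by (auto simp: forward_interval_def intro: order.strict_trans1[of "ereal _" "ereal t"])

lemma deriv_a: "t \<in> F \<Longrightarrow> (a has_vector_derivative (\<Sum>j\<in>UNIV. c t $ j *\<^sub>R column j (b t))) (at t within F)"
  using sol by (simp add: solves_on_def matrix_mult_sum scalar_mult_eq_scaleR)

lemma deriv_c:
  assumes "t \<in> F"
  shows "((\<lambda>t. c t $ i) has_real_derivative a t \<bullet> column i (b t)) (at t within F)"
proof -
  have "((\<lambda>t. c t $ i) has_vector_derivative (transpose (b t) *v a t) $ i) (at t within F)"
    using sol assms
    by (intro bounded_linear.has_vector_derivative[OF bounded_linear_vec_nth]) (auto simp: solves_on_def)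
  moreover have "(transpose (b t) *v a t) $ i = a t \<bullet> column i (b t)"
    by (simp add: matrix_vector_mult_def transpose_def inner_vec_def column_def mult.commute)
  ultimately show ?thesis
    by (simp add: has_real_derivative_iff_has_vector_derivative)
qed

lemma deriv_column:
  assumes "t \<in> F"
  shows "((\<lambda>t. column i (b t)) has_vector_derivative c t $ i *\<^sub>R a t) (at t within F)"
proof -
  have "bounded_linear (column i :: real^'m^'m \<Rightarrow> _)"
    by (intro linear_conv_bounded_linear[THEN iffD1] linearI) (auto simp: column_def vec_eq_iff)
  moreover have "(b has_vector_derivative (\<chi> k j. a t $ k * c t $ j)) (at t within F)"
    using sol assms by (simp add: solves_on_def)
  moreover have "column i (\<chi> k j. a t $ k * c t $ j) = c t $ i *\<^sub>R a t"
    by (simp add: column_def vec_eq_iff mult.commute)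
  ultimately show ?thesis using bounded_linear.has_vector_derivative by metis
qed

text \<open>The three terms come from c_i' = a \<bullet> b^i, from a' = sum of c_j b^j, and from
  (b^i)' = c_i a.\<close>

definition "rate' i t = (a t \<bullet> column i (b t))\<^sup>2 + (\<Sum>j\<in>UNIV. corr i j t) + (c t $ i)\<^sup>2 * (a t \<bullet> a t)"

lemma deriv_rate:
  assumes "t \<in> F"
  shows "(rate i has_real_derivative rate' i t) (at t within F)"
  unfolding rate_def[abs_def] rate'_def
  by (rule DERIV_cong[OF DERIV_mult[OF deriv_c[OF assms]
        has_real_derivative_inner[OF deriv_a[OF assms] deriv_column[OF assms]]]])
    (simp add: corr_def power2_eq_square inner_sum_right sum_distrib_left algebra_simps inner_commute)

definition "corr' i j t =
  ((a t \<bullet> column i (b t)) * c t $ j + c t $ i * (a t \<bullet> column j (b t))) * (column i (b t) \<bullet> column j (b t))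
    + (c t $ i * c t $ j) * (c t $ j * (column i (b t) \<bullet> a t) + c t $ i * (a t \<bullet> column j (b t)))"

lemma deriv_corr:
  assumes "t \<in> F"
  shows "(corr i j has_real_derivative corr' i j t) (at t within F)"
  unfolding corr_def[abs_def] corr'_def
  by (rule DERIV_cong[OF DERIV_mult[OF DERIV_mult[OF deriv_c[OF assms] deriv_c[OF assms]]
        has_real_derivative_inner[OF deriv_column[OF assms] deriv_column[OF assms]]]])
    (simp add: algebra_simps)

lemma rate'_ge:
  assumes "\<And>j. 0 < corr i j t"
  shows "(c t $ i)\<^sup>2 * (a t \<bullet> a t) \<le> rate' i t"
  using assms by (simp add: rate'_def sum_nonneg less_imp_le)

text \<open>The logarithmic derivative of c_i is rate_i / c_i^2, so the product rule expresses
  \<open>corr'\<close> through \<open>rate\<close> and \<open>corr\<close> with nonnegative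
  coefficients.\<close>

lemma corr'_nonneg:
  assumes "0 < rate i t" "0 < rate j t" "0 < corr i j t"
  shows "0 \<le> corr' i j t"
proof -
  have nz: "c t $ i \<noteq> 0" "c t $ j \<noteq> 0" using assms by (auto simp: rate_def)
  have "corr' i j t = (rate i t / (c t $ i)\<^sup>2 + rate j t / (c t $ j)\<^sup>2) * corr i j t
      + (c t $ i)\<^sup>2 * rate j t + (c t $ j)\<^sup>2 * rate i t"
    using nz by (simp add: corr'_def corr_def rate_def power2_eq_square field_simps inner_commute)
  then show ?thesis using assms by simp
qed

lemma column_final_stage_persists:
  assumes "t \<in> F" "t0 \<le> t"
  shows "0 < rate i t" and "0 < corr i j t"
proof -
  \<comment> \<open>A sum type joins both families, since each needs the positivity of the other in
    a single first-failure argument.\<close>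
  define f where "f k = (case k of Inl i \<Rightarrow> rate i | Inr (i, j) \<Rightarrow> corr i j)" for k :: "'m + 'm \<times> 'm"
  define f' where "f' k = (case k of Inl i \<Rightarrow> rate' i | Inr (i, j) \<Rightarrow> corr' i j)" for k :: "'m + 'm \<times> 'm"
  have pos: "0 < f k t" for k
  proof (rule positivity_persists[where S = F and s = t0 and f = f and f' = f'])
    show "(f k has_real_derivative f' k x) (at x within F)" if "x \<in> F" for k x
      unfolding f_def f'_def
      using that deriv_rate deriv_corr by (simp split: sum.split prod.split)
    have "0 < corr i j t0" for i j
      using corr_init[of i j] by (simp add: corr_def mult_ac)
    then show "0 < f k t0" for k
      using rate_init by (simp add: f_def rate_def split: sum.split prod.split)
    show "0 \<le> f' k x" if "x \<in> F" and pos: "\<And>l. 0 < f l x" for k x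
    proof -
      have p: "0 < rate i x" "0 < corr i j x" for i j
        using pos[of "Inl i"] pos[of "Inr (i, j)"] by (auto simp: f_def)
      have "0 \<le> rate' i x" for i
        by (rule order_trans[OF _ rate'_ge]) (use p in auto)
      then show ?thesis
        using corr'_nonneg p by (simp add: f'_def split: sum.split prod.split)
    qed
  qed (use assms interval_subset in auto)
  show "0 < rate i t" "0 < corr i j t"
    using pos[of "Inl i"] pos[of "Inr (i, j)"] by (auto simp: f_def)
qed

section \<open>Monotone quantities, conserved energy and blow-up\<close>

lemma deriv_c_squared:
  assumes "t \<in> F"
  shows "((\<lambda>t. (c t $ i)\<^sup>2) has_real_derivative 2 * rate i t) (at t within F)"
  by (rule DERIV_cong[OF DERIV_power[OF deriv_c[OF assms]]]) (simp add: rate_def)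

lemma c_squared_mono:
  assumes "s \<in> F" "t \<in> F" "t0 \<le> s" "s \<le> t"
  shows "(c s $ i)\<^sup>2 \<le> (c t $ i)\<^sup>2"
proof (rule nondecreasing_of_deriv_nonneg[OF deriv_c_squared])
  show sub: "{s..t} \<subseteq> F" using interval_subset assms by fastforce
  show "0 \<le> 2 * rate i x" if "s < x" "x < t" for x
  proof -
    have "x \<in> F" using that by (intro subsetD[OF sub]) auto
    then show ?thesis using column_final_stage_persists(1)[of x i] that assms by simp
  qed
qed (use assms in auto)

lemma deriv_norm_a_squared:
  assumes "t \<in> F"
  shows "((\<lambda>t. a t \<bullet> a t) has_real_derivative 2 * (\<Sum>i\<in>UNIV. rate i t)) (at t within F)"
  by (rule DERIV_cong[OF has_real_derivative_inner[OF deriv_a[OF assms] deriv_a[OF assms]]])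
    (simp add: rate_def inner_sum_left inner_sum_right inner_commute)

lemma norm_a_squared_ge:
  assumes "t \<in> F" "t0 \<le> t"
  shows "a t0 \<bullet> a t0 \<le> a t \<bullet> a t"
proof (rule nondecreasing_of_deriv_nonneg[OF deriv_norm_a_squared])
  show sub: "{t0..t} \<subseteq> F" using interval_subset assms by fastforce
  show "0 \<le> 2 * (\<Sum>i\<in>UNIV. rate i x)" if "t0 < x" "x < t" for x
  proof -
    have "x \<in> F" using that by (intro subsetD[OF sub]) auto
    then show ?thesis
      using column_final_stage_persists(1)[of x] that by (simp add: sum_nonneg less_imp_le)
  qed
qed (use assms in auto)

lemma norm_a_squared_pos: "0 < a t0 \<bullet> a t0"
  using rate_init by fastforce

text \<open>|a|^2, |b|^2 and |c|^2 all have the derivative 2 a \<bullet> (b c), so |b|^2 + |c|^2 - 2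
  |a|^2 is constant.\<close>

lemma energy_conserved:
  obtains E where "\<And>t. t \<in> F \<Longrightarrow> (norm (a t, b t, c t))\<^sup>2 = 3 * (a t \<bullet> a t) + E"
proof -
  have "convex F"
    by (auto simp: forward_interval_def is_interval_convex_1[symmetric] is_interval_1
        intro: order.strict_trans1[of "ereal _" "ereal _"])
  moreover have "((\<lambda>t. b t \<bullet> b t + c t \<bullet> c t - 2 * (a t \<bullet> a t)) has_real_derivative 0) (at t within F)"
    if t: "t \<in> F" for t
  proof -
    have b: "(b has_vector_derivative (\<chi> i j. a t $ i * c t $ j)) (at t within F)"
      and c: "(c has_vector_derivative transpose (b t) *v a t) (at t within F)"
      using sol t by (auto simp: solves_on_def)
    have rate: "(\<Sum>i\<in>UNIV. rate i t) = a t \<bullet> (b t *v c t)"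
      by (simp add: rate_def matrix_mult_sum scalar_mult_eq_scaleR inner_sum_right)
    have "b t \<bullet> (\<chi> i j. a t $ i * c t $ j) = a t \<bullet> (b t *v c t)"
      by (simp add: inner_vec_def matrix_vector_mult_def sum_distrib_left mult_ac)
    moreover have "c t \<bullet> (transpose (b t) *v a t) = a t \<bullet> (b t *v c t)"
      by (simp add: transpose_matrix_vector dot_lmul_matrix inner_commute[of "c t"])
    ultimately show ?thesis
      by (intro DERIV_cong[OF DERIV_diff[OF DERIV_add[OF has_real_derivative_inner[OF b b]
              has_real_derivative_inner[OF c c]] DERIV_cmult[OF deriv_norm_a_squared[OF t]]]])
        (simp add: rate inner_commute)
  qed
  ultimately have "\<exists>E. \<forall>t\<in>F. b t \<bullet> b t + c t \<bullet> c t - 2 * (a t \<bullet> a t) = E"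
    by (rule has_field_derivative_zero_constant)
  then obtain E where "\<And>t. t \<in> F \<Longrightarrow> b t \<bullet> b t + c t \<bullet> c t = 2 * (a t \<bullet> a t) + E"
    by (metis diff_add_cancel add.commute)
  then show thesis
    by (intro that[of E]) (simp add: power2_norm_eq_inner)
qed

lemma norm_le_norm_a:
  obtains \<kappa> where "0 < \<kappa>" "\<And>t. t \<in> F \<Longrightarrow> t0 \<le> t \<Longrightarrow> \<kappa> * (norm (a t, b t, c t))\<^sup>2 \<le> a t \<bullet> a t"
proof -
  obtain E where E: "\<And>t. t \<in> F \<Longrightarrow> (norm (a t, b t, c t))\<^sup>2 = 3 * (a t \<bullet> a t) + E"
    using energy_conserved by metis
  define \<alpha> where "\<alpha> = a t0 \<bullet> a t0"
  have \<alpha>: "0 < \<alpha>" using norm_a_squared_pos by (simp add: \<alpha>_def)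
  \<comment> \<open>Since |a|^2 stays above \<alpha>, the constant \<open>E\<close> is at most |E| /
    \<alpha> times |a|^2; the 3 is the factor in the energy identity.\<close>
  define d where "d = 3 + \<bar>E\<bar> / \<alpha>"
  have d: "0 < d" using \<alpha> by (simp add: d_def add_pos_nonneg)
  have "(1 / d) * (norm (a t, b t, c t))\<^sup>2 \<le> a t \<bullet> a t" if "t \<in> F" "t0 \<le> t" for t
  proof -
    have "\<bar>E\<bar> * 1 \<le> \<bar>E\<bar> * ((a t \<bullet> a t) / \<alpha>)"
      using norm_a_squared_ge[OF that] \<alpha> by (intro mult_left_mono) (auto simp: \<alpha>_def)
    then have "(norm (a t, b t, c t))\<^sup>2 \<le> d * (a t \<bullet> a t)"
      using E[OF that(1)] by (simp add: d_def algebra_simps)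
    then show ?thesis using d by (simp add: field_simps)
  qed
  with d show thesis by (intro that[of "1 / d"]) auto
qed

text \<open>For infinite \<open>T\<close> the rate stays above its initial value, so c_i^2 grows
  linearly. For finite \<open>T\<close> a bound on c_i^2 would bound the whole solution.\<close>

lemma c_unbounded:
  assumes max: "maximal_forward_solution T a b c"
  obtains t where "t \<in> F" "t0 \<le> t" "M < (c t $ i)\<^sup>2"
proof -
  have "\<exists>t\<in>F. t0 \<le> t \<and> M < (c t $ i)\<^sup>2"
  proof (cases T)
    case PInf
    then have F: "F = {0..}" by (simp add: atLeast_def forward_interval_def)
    define m where "m = 2 * rate i t0"
    have m: "0 < m" using column_final_stage_persists(1)[OF t0] by (simp add: m_def)
    \<comment> \<open>By this time the line of slope \<open>m\<close> has risen by |M| + 1; the 1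
      makes the final inequality strict.\<close>
    define t where "t = t0 + (\<bar>M\<bar> + 1) / m"
    have t: "t0 \<le> t" "t \<in> F" using m t0 by (simp_all add: t_def F)
    have rate_mono: "rate i t0 \<le> rate i x" if "t0 \<le> x" "x \<in> F" for x
    proof (rule nondecreasing_of_deriv_nonneg[OF deriv_rate])
      show "{t0..x} \<subseteq> F" using interval_subset that by auto
      show "0 \<le> rate' i y" if "t0 < y" "y < x" for y
      proof (rule order_trans[OF _ rate'_ge])
        show "0 < corr i j y" for j
          using that t0 by (intro column_final_stage_persists(2)) (auto simp: F)
      qed simp
    qed (use that in auto)
    have "(c t0 $ i)\<^sup>2 - m * t0 \<le> (c t $ i)\<^sup>2 - m * t"
    proof (rule nondecreasing_of_deriv_nonneg[where S = F and f = "\<lambda>t. (c t $ i)\<^sup>2 - m * t"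
          and f' = "\<lambda>t. 2 * rate i t - m"])
      show "((\<lambda>t. (c t $ i)\<^sup>2 - m * t) has_real_derivative 2 * rate i x - m) (at x within F)"
        if "x \<in> F" for x
        by (rule DERIV_cong[OF DERIV_diff[OF deriv_c_squared[OF that] DERIV_cmult[OF DERIV_ident]]]) simp
      show "0 \<le> 2 * rate i x - m" if "t0 < x" "x < t" for x
        using rate_mono[of x] that t0 by (simp add: m_def F)
    qed (use t interval_subset in auto)
    moreover have "m * t = m * t0 + \<bar>M\<bar> + 1" using m by (simp add: t_def field_simps)
    ultimately have "M < (c t $ i)\<^sup>2"
      using zero_le_power2[of "c t0 $ i"] by linarith
    then show ?thesis using t by blast
  next
    case MInf
    with t0 show ?thesis by (simp add: forward_interval_def)
  next
    case (real r)
    have F: "F = {0..<r}" using real by (simp add: forward_interval_ereal)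
    show ?thesis
    proof (rule ccontr)
      assume "\<not> ?thesis"
      then have c_le: "(c t $ i)\<^sup>2 \<le> M" if "t \<in> {t0..<r}" for t
        using that t0 F by force
      define X where "X = (\<lambda>t. (a t, b t, c t))"
      have X: "(X has_vector_derivative gradient_form (X t) (X t)) (at t within F)" if "t \<in> F" for t
        using sol[unfolded real solves_on_ereal_iff] that unfolding F X_def by blast
      interpret G: bounded_bilinear "gradient_form :: (real^'m) \<times> (real^'m^'m) \<times> (real^'m) \<Rightarrow> _"
        by (rule bounded_bilinear_gradient_form)
      obtain K where K: "0 < K" "\<And>t. norm (gradient_form (X t) (X t)) \<le> norm (X t) * norm (X t) * K"
        using G.pos_bounded by blast
      obtain \<kappa> where \<kappa>: "0 < \<kappa>" "\<And>t. t \<in> F \<Longrightarrow> t0 \<le> t \<Longrightarrow> \<kappa> * (norm (X t))\<^sup>2 \<le> a t \<bullet> a t"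
        using norm_le_norm_a unfolding X_def by blast
      \<comment> \<open>From rate_i' \<ge> c_i^2 |a|^2, the monotonicity of c_i^2 and |a|^2 \<ge>
        \<kappa> |X|^2.\<close>
      define \<delta> where "\<delta> = (c t0 $ i)\<^sup>2 * \<kappa>"
      have "c t0 $ i \<noteq> 0" using rate_init[of i] by auto
      then have \<delta>: "0 < \<delta>" using \<kappa> by (simp add: \<delta>_def)
      have sub: "{t0..<r} \<subseteq> F" using t0 F by auto
      \<comment> \<open>A zero state would have rate zero. Positivity makes the norm differentiable
        and its logarithm defined.\<close>
      have X_pos: "0 < norm (X t)" if "t \<in> {t0..<r}" for t
        using column_final_stage_persists(1)[of t i] that sub
        by (auto simp: X_def rate_def zero_prod_def)
      obtain B where B: "\<And>t. t \<in> {t0..<r} \<Longrightarrow> norm (X t) \<le> B"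
      proof (rule bounded_of_log_growth[where h = "\<lambda>t. norm (X t)" and p = "rate i" and p' = "rate' i"
            and s = "\<lambda>t. (c t $ i)\<^sup>2" and M = M and K = K and \<delta> = \<delta>
            and h' = "\<lambda>t. X t \<bullet> gradient_form (X t) (X t) / norm (X t)"])
        fix x assume x: "x \<in> {t0..<r}"
        then have xF: "x \<in> F" using sub by auto
        have "((\<lambda>t. sqrt (X t \<bullet> X t)) has_real_derivative X x \<bullet> gradient_form (X x) (X x) / norm (X x)) (at x within {t0..<r})"
          using X_pos[OF x]
          by (intro DERIV_cong[OF DERIV_subset[OF DERIV_chain2[OF DERIV_real_sqrt has_real_derivative_inner[OF X[OF xF] X[OF xF]]] sub]])
            (auto simp: norm_eq_sqrt_inner inner_commute field_simps)
        then show "((\<lambda>t. norm (X t)) has_real_derivative X x \<bullet> gradient_form (X x) (X x) / norm (X x)) (at x within {t0..<r})"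
          by (simp add: norm_eq_sqrt_inner)
        show "(rate i has_real_derivative rate' i x) (at x within {t0..<r})"
          by (rule DERIV_subset[OF deriv_rate[OF xF] sub])
        show "((\<lambda>t. (c t $ i)\<^sup>2) has_real_derivative 2 * rate i x) (at x within {t0..<r})"
          by (rule DERIV_subset[OF deriv_c_squared[OF xF] sub])
        have "X x \<bullet> gradient_form (X x) (X x) \<le> norm (X x) * norm (gradient_form (X x) (X x))"
          by (rule norm_cauchy_schwarz)
        also have "\<dots> \<le> norm (X x) * (norm (X x) * norm (X x) * K)"
          by (intro mult_left_mono K) auto
        finally show "X x \<bullet> gradient_form (X x) (X x) / norm (X x) \<le> K * (norm (X x))\<^sup>2"
          using X_pos[OF x] by (simp add: field_simps power2_eq_square)
        have "\<delta> * (norm (X x))\<^sup>2 \<le> (c t0 $ i)\<^sup>2 * (a x \<bullet> a x)"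
          using \<kappa>(2)[OF xF] x by (simp add: \<delta>_def mult.assoc mult_left_mono)
        also have "\<dots> \<le> (c x $ i)\<^sup>2 * (a x \<bullet> a x)"
          using c_squared_mono[of t0 x i] t0 xF x by (intro mult_right_mono) auto
        also have "\<dots> \<le> rate' i x"
          using column_final_stage_persists(2)[OF xF] x by (intro rate'_ge) auto
        finally show "\<delta> * (norm (X x))\<^sup>2 \<le> rate' i x" .
      qed (use X_pos c_le K \<delta> in auto)
      \<comment> \<open>The growth estimate starts at \<open>t0\<close>; the earlier stretch is
        bounded by compactness.\<close>
      have "compact (X ` {0..t0})"
      proof (rule compact_continuous_image)
        have "continuous_on F X"
          by (rule continuous_on_vector_derivative[OF X])
        then show "continuous_on {0..t0} X"
        proof (rule continuous_on_subset)
          show "{0..t0} \<subseteq> F" using t0 unfolding F by auto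
        qed
      qed simp
      then have "bounded (X ` {0..t0})" by (rule compact_imp_bounded)
      moreover have "bounded (X ` {t0..<r})"
        unfolding bounded_iff using B by blast
      ultimately have "bounded (X ` {0..t0} \<union> X ` {t0..<r})" by simp
      moreover have "{0..<r} \<subseteq> {0..t0} \<union> {t0..<r}" by auto
      ultimately have "bounded (X ` {0..<r})"
        unfolding image_Un[symmetric] by (meson bounded_subset image_mono)
      then show False
        using maximal_forward_solution_unbounded max unfolding X_def real by blast
    qed
  qed
  then show thesis using that by blast
qed

section \<open>Constant signs and limits of the entries of c\<close>

lemma c_same_sign:
  assumes "t \<in> F" "t0 \<le> t"
  shows "0 < c t0 $ i * c t $ i"
proof (rule ccontr)
  assume neg: "\<not> 0 < c t0 $ i * c t $ i"
  have c0: "c t0 $ i \<noteq> 0" using rate_init[of i] by auto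
  have "continuous_on F (\<lambda>t. c t $ i)" by (rule DERIV_continuous_on[OF deriv_c])
  then have "continuous_on {t0..t} (\<lambda>t. c t0 $ i * c t $ i)"
    by (intro continuous_on_mult_left continuous_on_subset[OF _ interval_subset[OF assms(1)]])
  moreover have "0 \<le> c t0 $ i * c t0 $ i" by simp
  \<comment> \<open>A sign change would force a zero of c_i, where the rate vanishes although it
    must be positive.\<close>
  ultimately obtain x where x: "t0 \<le> x" "x \<le> t" "c t0 $ i * c x $ i = 0"
    using IVT2'[of "\<lambda>t. c t0 $ i * c t $ i" t 0 t0] neg assms by (auto simp: not_less)
  then have "x \<in> F" using interval_subset[OF assms(1)] by auto
  then show False
    using column_final_stage_persists(1)[of x i] x c0 by (simp add: rate_def)
qed

text \<open>Once c_i^2 has exceeded Z^2 it stays above by monotonicity. Keeping the sign relative to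
  time \<open>t0\<close> serves both possible limits.\<close>

lemma eventually_abs_c_ge:
  assumes max: "maximal_forward_solution T a b c"
  shows "\<forall>\<^sub>F y in at_left T. \<bar>Z\<bar> \<le> \<bar>c (real_of_ereal y) $ i\<bar> \<and> 0 < c t0 $ i * c (real_of_ereal y) $ i"
proof -
  obtain t1 where t1: "t1 \<in> F" "t0 \<le> t1" "Z\<^sup>2 < (c t1 $ i)\<^sup>2"
    by (rule c_unbounded[OF max])
  have *: "\<bar>Z\<bar> \<le> \<bar>c t $ i\<bar> \<and> 0 < c t0 $ i * c t $ i" if "t \<in> F" "t1 \<le> t" for t
    using c_squared_mono[OF t1(1) that(1) t1(2) that(2), of i] t1 that c_same_sign[of t i]
    by (simp add: abs_le_square_iff)
  have T: "ereal t1 < T" using t1 by (simp add: forward_interval_def)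
  show ?thesis
    unfolding eventually_at_left[OF T]
  proof (intro exI[of _ "ereal t1"] conjI allI impI T)
    fix y assume "ereal t1 < y" "y < T"
    then obtain u where "y = ereal u" "t1 \<le> u" "u \<in> F"
      using t1 by (cases y) (auto simp: forward_interval_def)
    then show "\<bar>Z\<bar> \<le> \<bar>c (real_of_ereal y) $ i\<bar>" "0 < c t0 $ i * c (real_of_ereal y) $ i"
      using *[of u] by auto
  qed
qed

lemma condensed_of_maximal:
  assumes max: "maximal_forward_solution T a b c"
  shows "condensed T c"
  unfolding condensed_def
proof
  fix i
  note ev = eventually_abs_c_ge[OF max, where i = i]
  have "c t0 $ i \<noteq> 0" using rate_init[of i] by auto
  \<comment> \<open>The sign of c_i at \<open>t0\<close> decides which of the two infinities is the
    limit.\<close>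
  then consider "0 < c t0 $ i" | "c t0 $ i < 0" by linarith
  then show "filterlim (\<lambda>t. c (real_of_ereal t) $ i) at_top (at_left T) \<or>
      filterlim (\<lambda>t. c (real_of_ereal t) $ i) at_bot (at_left T)"
  proof cases
    case 1
    show ?thesis
      unfolding filterlim_at_top
    proof (intro disjI1 allI)
      fix Z
      show "\<forall>\<^sub>F t in at_left T. Z \<le> c (real_of_ereal t) $ i"
        using ev[of Z]
        by (rule eventually_mono) (use 1 in \<open>auto simp: zero_less_mult_iff\<close>)
    qed
  next
    case 2
    show ?thesis
      unfolding filterlim_at_bot
    proof (intro disjI2 allI)
      fix Z
      show "\<forall>\<^sub>F t in at_left T. c (real_of_ereal t) $ i \<le> Z"
        using ev[of Z]
        by (rule eventually_mono) (use 2 in \<open>auto simp: zero_less_mult_iff\<close>)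
    qed
  qed
qed

end

theorem theorem3:
  fixes a c :: "real \<Rightarrow> real^'m" and b :: "real \<Rightarrow> real^'m^'m"
    and T :: ereal and t0 :: real
  assumes "maximal_forward_solution T a b c"
    and "t0 \<in> forward_interval T"
    and "final_stage (a t0) (b t0) (c t0)"
  shows "condensed T c"
proof -
  interpret column_final_stage a c b T t0
    using assms by unfold_locales (auto simp: maximal_forward_solution_def final_stage_def)
  show ?thesis using assms(1) by (rule condensed_of_maximal)
qed

end
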